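(* There exists a closed order-$1$ PHFL formula $\varphi$ of type $\mathbf{Prop}$ that is not equivalent to any $\mu^p$-calculus formula; that is, for every closed order-$0$ PHFL formula $\varphi'$ of type $\mathbf{Prop}$ there is a Markov chain $M$ such that $M\models\varphi$ holds and $M\models\varphi'$ fails, or vice versa.
   Context: A Markov chain over a set $AP$ of atomic propositions is a tuple $M=(S,P,L,s_{in})$ with $S$ a finite set of states, $P:S\times S\to[0,1]$ satisfying $\sum_{s'\in S}P(s,s')=1$ for all $s$, $L:AP\to 2^S$ a labeling and $s_{in}\in S$ the initial state; $AP$ is assumed closed under negation (for each $p$ there is $\bar p\in AP$ with $L(\bar p)=S\setminus L(p)$). PHFL types: $\tau::=\mathbf{Prop}\mid\tau_1\to\tau_2$, with order $\mathrm{ord}(\mathbf{Prop})=0$, $\mathrm{ord}(\tau_1\to\tau_2)=\max(\mathrm{ord}(\tau_1)+1,\mathrm{ord}(\tau_2))$. PHFL formulas: $\varphi::=p\mid X\mid\varphi_1\lor\varphi_2\mid\varphi_1\land\varphi_2\mid[\varphi]_J\mid\Box\varphi\mid\Diamond\varphi\mid\bigcirc\varphi\mid\mu X.\varphi\mid\nu X.\varphi\mid\lambda X.\varphi\mid\varphi_1\,\varphi_2$, where $p\in AP$, $X$ ranges over variables, and $J$ is "$>r$" or "$\ge r$" for a rational $r\in[0,1]$ (the trivial bounds $>1$ and $\ge 0$ are excluded). Formulas are simply typed under a type environment $\Gamma$: $p:\mathbf{Prop}$; $X:\Gamma(X)$; $\lor,\land$ (binary) and $[\cdot]_J,\Box,\Diamond,\bigcirc$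 (unary) take arguments of type $\mathbf{Prop}$ and return $\mathbf{Prop}$; if $\Gamma,X:\tau\vdash\varphi:\tau$ then $\mu X.\varphi:\tau$ and $\nu X.\varphi:\tau$; abstraction and application are typed as in the simply typed $\lambda$-calculus. The order of a well-typed formula is the largest order of a type used in its typing derivation. Semantics relative to $M$: $[\![\mathbf{Prop}]\!]$ is the set of functions $S\to[0,1]$ ordered pointwise, $[\![\tau_1\to\tau_2]\!]$ the set of monotone functions $[\![\tau_1]\!]\to[\![\tau_2]\!]$ ordered pointwise. Given an environment $\rho$: $[\![p]\!]\rho(s)=1$ if $s\in L(p)$ and $0$ otherwise; $[\![X]\!]\rho=\rho(X)$; $\land,\lor$ are pointwise $\min,\max$; $[\![[\varphi]_J]\!]\rho(s)=1$ if $[\![\varphi]\!]\rho(s)\in J$ and $0$ otherwise; $[\![\Box\varphi]\!]\rho(s)=\min_{s':P(s,s')>0}[\![\varphi]\!]\rho(s')$; $[\![\Diamond\varphi]\!]\rho(s)=\max_{s':P(s,s')>0}[\![\varphi]\!]\rho(s')$; $[\![\bigcirc\varphi]\!]\rho(s)=\sum_{s'}P(s,s')\,[\![\varphi]\!]\rho(s')$; $\mu X.\varphi$ / $\nu X.\varphi$ denote the least / greatest fixpoint of $v\mapsto[\![\varphi]\!]\rho[X\mapsto v]$; $\lambda$ and application denote function abstraction and application. For a closed $\varphi$ of type $\mathbf{Prop}$, $M\models\varphi$ iff $[\![\varphi]\!](s_{in})=1$. The $\mu^p$-calculus is exactly the order-$0$ fragment of PHFL. *)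

theory Defs
  imports Complex_Main "HOL-Library.FuncSet"
begin

section \<open>Markov chains\<close>

record ('s, 'p) mchain =
  states :: "'s set"
  prob :: "'s \<Rightarrow> 's \<Rightarrow> real"
  label :: "'p \<Rightarrow> 's set"
  init :: 's

text \<open>The set of atomic propositions is the whole type \<open>'p\<close>; the operation \<open>neg\<close> sends a
  proposition to its complement, which every chain has to respect.\<close>

definition markov_chain :: "('p \<Rightarrow> 'p) \<Rightarrow> ('s, 'p) mchain \<Rightarrow> bool" where
  "markov_chain neg M \<longleftrightarrow>
     finite (states M) \<and> init M \<in> states M \<and>
     (\<forall>s\<in>states M. \<forall>s'\<in>states M. prob M s s' \<in> {0..1}) \<and>
     (\<forall>s\<in>states M. (\<Sum>s'\<in>states M. prob M s s') = 1) \<and>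
     (\<forall>p. label M p \<subseteq> states M) \<and>
     (\<forall>p. label M (neg p) = states M - label M p)"

definition succs :: "('s, 'p) mchain \<Rightarrow> 's \<Rightarrow> 's set" where
  "succs M s = {s' \<in> states M. prob M s s' > 0}"

section \<open>Syntax and typing\<close>

datatype ty = Prop | Arr ty ty

fun ord :: "ty \<Rightarrow> nat" where
  "ord Prop = 0"
| "ord (Arr a b) = max (ord a + 1) (ord b)"

datatype bound = Gt rat | Ge rat

fun bound_ok :: "bound \<Rightarrow> bool" where
  "bound_ok (Gt r) \<longleftrightarrow> 0 \<le> r \<and> r < 1"
| "bound_ok (Ge r) \<longleftrightarrow> 0 < r \<and> r \<le> 1"

fun in_bound :: "real \<Rightarrow> bound \<Rightarrow> bool" where
  "in_bound x (Gt r) \<longleftrightarrow> x > of_rat r"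
| "in_bound x (Ge r) \<longleftrightarrow> x \<ge> of_rat r"

datatype 'p phfl =
    Atom 'p
  | Var nat
  | Or "'p phfl" "'p phfl"
  | And "'p phfl" "'p phfl"
  | Thr "'p phfl" bound
  | Box "'p phfl"
  | Dia "'p phfl"
  | Next "'p phfl"
  | Mu nat "'p phfl"
  | Nu nat "'p phfl"
  | Lam nat "'p phfl"
  | App "'p phfl" "'p phfl"

text \<open>\<open>typed \<Gamma> \<phi> \<tau> n\<close>: there is a derivation of \<open>\<Gamma> \<turnstile> \<phi> : \<tau>\<close> in which the largest order of a type
  is \<open>n\<close>.  As \<open>ord \<tau> \<le> n\<close> always holds (see \<open>typed_ord_le\<close>), types of premises need not be counted
  again in the conclusion.  The admissible bounds of the grammar are enforced in rule \<open>thr\<close>.\<close>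

inductive typed :: "(nat \<rightharpoonup> ty) \<Rightarrow> 'p phfl \<Rightarrow> ty \<Rightarrow> nat \<Rightarrow> bool" where
  atom: "typed \<Gamma> (Atom p) Prop 0"
| var: "\<Gamma> x = Some \<tau> \<Longrightarrow> typed \<Gamma> (Var x) \<tau> (ord \<tau>)"
| disj: "typed \<Gamma> \<phi> Prop m \<Longrightarrow> typed \<Gamma> \<psi> Prop n \<Longrightarrow> typed \<Gamma> (Or \<phi> \<psi>) Prop (max m n)"
| conj: "typed \<Gamma> \<phi> Prop m \<Longrightarrow> typed \<Gamma> \<psi> Prop n \<Longrightarrow> typed \<Gamma> (And \<phi> \<psi>) Prop (max m n)"
| thr: "typed \<Gamma> \<phi> Prop n \<Longrightarrow> bound_ok J \<Longrightarrow> typed \<Gamma> (Thr \<phi> J) Prop n"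
| box: "typed \<Gamma> \<phi> Prop n \<Longrightarrow> typed \<Gamma> (Box \<phi>) Prop n"
| dia: "typed \<Gamma> \<phi> Prop n \<Longrightarrow> typed \<Gamma> (Dia \<phi>) Prop n"
| nxt: "typed \<Gamma> \<phi> Prop n \<Longrightarrow> typed \<Gamma> (Next \<phi>) Prop n"
| mu: "typed (\<Gamma>(x \<mapsto> \<tau>)) \<phi> \<tau> n \<Longrightarrow> typed \<Gamma> (Mu x \<phi>) \<tau> n"
| nu: "typed (\<Gamma>(x \<mapsto> \<tau>)) \<phi> \<tau> n \<Longrightarrow> typed \<Gamma> (Nu x \<phi>) \<tau> n"
| lam: "typed (\<Gamma>(x \<mapsto> \<sigma>)) \<phi> \<tau> n \<Longrightarrow> typed \<Gamma> (Lam x \<phi>) (Arr \<sigma> \<tau>) (max n (ord (Arr \<sigma> \<tau>)))"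
| app: "typed \<Gamma> \<phi> (Arr \<sigma> \<tau>) m \<Longrightarrow> typed \<Gamma> \<psi> \<sigma> n \<Longrightarrow> typed \<Gamma> (App \<phi> \<psi>) \<tau> (max m n)"

lemma typed_ord_le: "typed \<Gamma> \<phi> \<tau> n \<Longrightarrow> ord \<tau> \<le> n"
  by (induction rule: typed.induct) auto

definition closed_prop :: "nat \<Rightarrow> 'p phfl \<Rightarrow> bool" where
  "closed_prop n \<phi> \<longleftrightarrow> typed Map.empty \<phi> Prop n"

section \<open>Semantics of formulas of order at most one\<close>

text \<open>The full monotone type hierarchy over \<open>[0,1]\<close> does not fit uniformly into one HOL type, so
  the semantics is given for derivations of order at most one.  There all argument types are
  \<open>Prop\<close>, every type is \<open>Prop \<rightarrow> \<dots> \<rightarrow> Prop \<rightarrow> Prop\<close>, and its elements are curried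
  functions.  Functions are kept extensional (\<open>undefined\<close> outside their domain) so that equality of
  values is equality of set-theoretic functions.\<close>

datatype 's val = PropV (prop_of: "'s \<Rightarrow> real") | FunV (fun_of: "('s \<Rightarrow> real) \<Rightarrow> 's val")

definition prop_dom :: "'s set \<Rightarrow> ('s \<Rightarrow> real) set" where
  "prop_dom S = S \<rightarrow>\<^sub>E {0..1}"

fun val_le :: "'s set \<Rightarrow> ty \<Rightarrow> 's val \<Rightarrow> 's val \<Rightarrow> bool" where
  "val_le S Prop x y \<longleftrightarrow> (\<forall>s\<in>S. prop_of x s \<le> prop_of y s)"
| "val_le S (Arr _ \<tau>) x y \<longleftrightarrow> (\<forall>v\<in>prop_dom S. val_le S \<tau> (fun_of x v) (fun_of y v))"

text \<open>The last equation is a dummy: such types have order at least two.\<close>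

fun val_dom :: "'s set \<Rightarrow> ty \<Rightarrow> 's val set" where
  "val_dom S Prop = PropV ` prop_dom S"
| "val_dom S (Arr Prop \<tau>) = FunV ` {f \<in> prop_dom S \<rightarrow>\<^sub>E val_dom S \<tau>.
     \<forall>v\<in>prop_dom S. \<forall>w\<in>prop_dom S. (\<forall>s\<in>S. v s \<le> w s) \<longrightarrow> val_le S \<tau> (f v) (f w)}"
| "val_dom S (Arr (Arr _ _) _) = {}"

definition least_fp :: "'s set \<Rightarrow> ty \<Rightarrow> ('s val \<Rightarrow> 's val) \<Rightarrow> 's val" where
  "least_fp S \<tau> F = (THE v. v \<in> val_dom S \<tau> \<and> F v = v \<and>
     (\<forall>w\<in>val_dom S \<tau>. F w = w \<longrightarrow> val_le S \<tau> v w))"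

definition greatest_fp :: "'s set \<Rightarrow> ty \<Rightarrow> ('s val \<Rightarrow> 's val) \<Rightarrow> 's val" where
  "greatest_fp S \<tau> F = (THE v. v \<in> val_dom S \<tau> \<and> F v = v \<and>
     (\<forall>w\<in>val_dom S \<tau>. F w = w \<longrightarrow> val_le S \<tau> w v))"

fun result_ty :: "ty \<Rightarrow> ty" where
  "result_ty (Arr _ \<tau>) = \<tau>"
| "result_ty Prop = Prop"

text \<open>\<open>sem M \<phi> \<tau> \<rho>\<close> is the value of \<open>\<phi>\<close> at type \<open>\<tau>\<close>.  In a derivation of order at most one the
  argument of an application has type \<open>Prop\<close>, so \<open>\<phi>\<close> and \<open>\<tau>\<close> determine the types of all
  subformulas, and in particular the domain in which each fixpoint is taken.\<close>

primrec sem :: "('s, 'p) mchain \<Rightarrow> 'p phfl \<Rightarrow> ty \<Rightarrow> (nat \<Rightarrow> 's val) \<Rightarrow> 's val" where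
  "sem M (Atom p) \<tau> \<rho> = PropV (\<lambda>s\<in>states M. if s \<in> label M p then 1 else 0)"
| "sem M (Var x) \<tau> \<rho> = \<rho> x"
| "sem M (Or \<phi> \<psi>) \<tau> \<rho> =
     PropV (\<lambda>s\<in>states M. max (prop_of (sem M \<phi> Prop \<rho>) s) (prop_of (sem M \<psi> Prop \<rho>) s))"
| "sem M (And \<phi> \<psi>) \<tau> \<rho> =
     PropV (\<lambda>s\<in>states M. min (prop_of (sem M \<phi> Prop \<rho>) s) (prop_of (sem M \<psi> Prop \<rho>) s))"
| "sem M (Thr \<phi> J) \<tau> \<rho> =
     PropV (\<lambda>s\<in>states M. if in_bound (prop_of (sem M \<phi> Prop \<rho>) s) J then 1 else 0)"
| "sem M (Box \<phi>) \<tau> \<rho> =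
     PropV (\<lambda>s\<in>states M. Min (prop_of (sem M \<phi> Prop \<rho>) ` succs M s))"
| "sem M (Dia \<phi>) \<tau> \<rho> =
     PropV (\<lambda>s\<in>states M. Max (prop_of (sem M \<phi> Prop \<rho>) ` succs M s))"
| "sem M (Next \<phi>) \<tau> \<rho> =
     PropV (\<lambda>s\<in>states M. \<Sum>s'\<in>states M. prob M s s' * prop_of (sem M \<phi> Prop \<rho>) s')"
| "sem M (Mu x \<phi>) \<tau> \<rho> = least_fp (states M) \<tau> (\<lambda>v. sem M \<phi> \<tau> (\<rho>(x := v)))"
| "sem M (Nu x \<phi>) \<tau> \<rho> = greatest_fp (states M) \<tau> (\<lambda>v. sem M \<phi> \<tau> (\<rho>(x := v)))"
| "sem M (Lam x \<phi>) \<tau> \<rho> =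
     FunV (\<lambda>v\<in>prop_dom (states M). sem M \<phi> (result_ty \<tau>) (\<rho>(x := PropV v)))"
| "sem M (App \<phi> \<psi>) \<tau> \<rho> = fun_of (sem M \<phi> (Arr Prop \<tau>) \<rho>) (prop_of (sem M \<psi> Prop \<rho>))"

text \<open>For closed formulas; the initial environment is irrelevant.\<close>

definition models :: "('s, 'p) mchain \<Rightarrow> 'p phfl \<Rightarrow> bool" where
  "models M \<phi> \<longleftrightarrow> prop_of (sem M \<phi> Prop (\<lambda>_. undefined)) (init M) = 1"

end

theory Submission imports Defs begin

text \<open>Idea: on a chain in which every state has one successor and all labels are Boolean, the
  thresholds are trivial and the three modalities coincide, so a \<open>\<mu>\<^sup>p\<close>-formula is a
  linear-time \<open>\<mu>\<close>-calculus formula and defines a regular property.  The chains used are the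
  words \<open>p\<^sup>n q\<^sup>m p p p \<dots>\<close>, numbered backwards from the final loop at state \<open>0\<close>.  The
  truth values at a state of all arguments of modalities inside a formula form a bit vector of fixed
  length, which determines the vector at the preceding state; so by the pigeonhole principle the
  formula cannot tell \<open>q\<^sup>m p p p \<dots>\<close> from \<open>q\<^sup>k p p p \<dots>\<close> behind any prefix \<open>p\<^sup>n\<close>, for some
  \<open>m < k\<close>.  The order-one formula
  \<open>(\<mu>F. \<lambda>X. (\<not>p \<and> X) \<or> (p \<and> \<circle>F(\<circle>X))) p\<close> expresses \<open>m \<le> n\<close> and separates
  the two words for \<open>n = m\<close>.\<close>

section \<open>Fixpoints\<close>

text \<open>The order compares values on \<open>S\<close> only; antisymmetry holds because functions
  in \<open>val_dom\<close> are extensional. It gives the uniqueness demanded by the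
  \<open>THE\<close> in both fixpoint definitions.\<close>

lemma val_le_antisym:
  "\<lbrakk>x \<in> val_dom S \<tau>; y \<in> val_dom S \<tau>; val_le S \<tau> x y; val_le S \<tau> y x\<rbrakk> \<Longrightarrow> x = y"
proof (induction S \<tau> arbitrary: x y rule: val_dom.induct)
  case (1 S)
  then obtain v w where "x = PropV v" "y = PropV w" "v \<in> prop_dom S" "w \<in> prop_dom S"
    by auto
  moreover from this 1 have "v s = w s" if "s \<in> S" for s
    using that by (auto intro: order_antisym)
  ultimately show ?case
    by (auto simp: prop_dom_def intro: PiE_ext)
next
  case (2 S \<tau>)
  then obtain f g where *: "x = FunV f" "y = FunV g"
    "f \<in> prop_dom S \<rightarrow>\<^sub>E val_dom S \<tau>" "g \<in> prop_dom S \<rightarrow>\<^sub>E val_dom S \<tau>"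
    by auto
  have "f v = g v" if "v \<in> prop_dom S" for v
    using 2 * that by (auto intro!: "2.IH" dest: PiE_mem)
  with * show ?case by (auto intro: PiE_ext)
qed auto

lemma least_fp_eqI:
  assumes "v \<in> val_dom S \<tau>" "F v = v"
    and "\<And>w. w \<in> val_dom S \<tau> \<Longrightarrow> F w = w \<Longrightarrow> val_le S \<tau> v w"
  shows "least_fp S \<tau> F = v"
  unfolding least_fp_def
  by (rule the_equality) (use assms in \<open>auto intro: val_le_antisym\<close>)

lemma greatest_fp_eqI:
  assumes "v \<in> val_dom S \<tau>" "F v = v"
    and "\<And>w. w \<in> val_dom S \<tau> \<Longrightarrow> F w = w \<Longrightarrow> val_le S \<tau> w v"
  shows "greatest_fp S \<tau> F = v"
  unfolding greatest_fp_def
  by (rule the_equality) (use assms in \<open>auto intro: val_le_antisym\<close>)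

lemma val_dom_PropI:
  "(\<And>s. s \<in> S \<Longrightarrow> 0 \<le> f s \<and> f s \<le> 1) \<Longrightarrow> PropV (\<lambda>s\<in>S. f s) \<in> val_dom S Prop"
  by (auto simp: prop_dom_def)

lemma val_dom_PropD:
  "v \<in> val_dom S Prop \<Longrightarrow> s \<in> S \<Longrightarrow> 0 \<le> prop_of v s \<and> prop_of v s \<le> 1"
  by (auto simp: prop_dom_def PiE_iff)

lemma val_le_Prop_refl: "val_le S Prop v v"
  by simp

lemma val_le_Prop_trans: "val_le S Prop u v \<Longrightarrow> val_le S Prop v w \<Longrightarrow> val_le S Prop u w"
  by (auto intro: order_trans)

text \<open>Knaster-Tarski on \<open>[0,1]\<close>-valued functions: the pointwise infimum of all
  prefixed points is the least fixpoint. Minimality is stated against prefixed points, which allows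
  fixpoints of two different maps to be compared later.\<close>

lemma least_fp_Prop:
  assumes dom: "\<And>v. v \<in> val_dom S Prop \<Longrightarrow> F v \<in> val_dom S Prop"
    and mono: "\<And>v w. v \<in> val_dom S Prop \<Longrightarrow> w \<in> val_dom S Prop \<Longrightarrow> val_le S Prop v w \<Longrightarrow>
      val_le S Prop (F v) (F w)"
  shows "least_fp S Prop F \<in> val_dom S Prop" (is "?l \<in> _")
    and "F (least_fp S Prop F) = least_fp S Prop F"
    and "\<And>w. w \<in> val_dom S Prop \<Longrightarrow> val_le S Prop (F w) w \<Longrightarrow>
      val_le S Prop (least_fp S Prop F) w"
proof -
  define W where "W = {w \<in> val_dom S Prop. val_le S Prop (F w) w}"
  define m where "m = PropV (\<lambda>s\<in>S. Inf ((\<lambda>w. prop_of w s) ` W))"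
  \<comment> \<open>The constant 1 keeps the set of prefixed points nonempty, without which the real
    infimum would carry no information.\<close>
  have one: "PropV (\<lambda>s\<in>S. 1) \<in> W"
  proof -
    have "PropV (\<lambda>s\<in>S. 1) \<in> val_dom S Prop" by (rule val_dom_PropI) simp
    with val_dom_PropD[OF dom[OF this]] show ?thesis
      by (simp add: W_def del: val_dom.simps)
  qed
  have lower: "prop_of m s \<le> prop_of w s" if "w \<in> W" "s \<in> S" for w s
    unfolding m_def using that
    by (auto intro!: cInf_lower bdd_belowI[of _ 0] simp: W_def dest: val_dom_PropD
        simp del: val_dom.simps)
  have greatest: "c \<le> prop_of m s" if "s \<in> S" "\<And>w. w \<in> W \<Longrightarrow> c \<le> prop_of w s" for c s
    unfolding m_def using that one by (auto intro!: cInf_greatest)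
  have "m = PropV (\<lambda>s\<in>S. prop_of m s)" by (auto simp: m_def intro!: restrict_ext)
  moreover have "PropV (\<lambda>s\<in>S. prop_of m s) \<in> val_dom S Prop"
  proof (rule val_dom_PropI)
    fix s assume s: "s \<in> S"
    have "0 \<le> prop_of w s" if "w \<in> W" for w
      using that s val_dom_PropD[of w S s] by (simp add: W_def)
    then show "0 \<le> prop_of m s \<and> prop_of m s \<le> 1"
      using lower[OF one s] greatest[OF s] s by simp
  qed
  ultimately have mD: "m \<in> val_dom S Prop" by simp
  have le: "val_le S Prop m w" if "w \<in> W" for w
    using lower that by simp
  have "val_le S Prop (F m) m"
  proof -
    have "prop_of (F m) s \<le> prop_of w s" if "w \<in> W" "s \<in> S" for w s
      using val_le_Prop_trans[of S "F m" "F w" w] mono[OF mD, of w] le[OF that(1)] that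
      by (auto simp: W_def)
    then show ?thesis using greatest by auto
  qed
  moreover from this have "F m \<in> W" using dom mD mono by (auto simp: W_def simp del: val_le.simps val_dom.simps)
  ultimately have fp: "F m = m"
    using le dom mD by (auto intro!: val_le_antisym simp del: val_le.simps val_dom.simps)
  have "least_fp S Prop F = m"
    using mD fp le by (intro least_fp_eqI) (auto simp: W_def)
  then show "?l \<in> val_dom S Prop" "F ?l = ?l"
    "\<And>w. w \<in> val_dom S Prop \<Longrightarrow> val_le S Prop (F w) w \<Longrightarrow> val_le S Prop ?l w"
    using mD fp le by (auto simp: W_def)
qed

text \<open>Duality: \<open>v \<mapsto> 1 - v\<close> is an order-reversing involution of the
  domain, so the least fixpoint of the conjugated map \<open>G\<close> is the complement of the
  greatest fixpoint of \<open>F\<close>.\<close>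

lemma greatest_fp_Prop:
  assumes dom: "\<And>v. v \<in> val_dom S Prop \<Longrightarrow> F v \<in> val_dom S Prop"
    and mono: "\<And>v w. v \<in> val_dom S Prop \<Longrightarrow> w \<in> val_dom S Prop \<Longrightarrow> val_le S Prop v w \<Longrightarrow>
      val_le S Prop (F v) (F w)"
  shows "greatest_fp S Prop F \<in> val_dom S Prop" (is "?g \<in> _")
    and "F (greatest_fp S Prop F) = greatest_fp S Prop F"
    and "\<And>w. w \<in> val_dom S Prop \<Longrightarrow> val_le S Prop w (F w) \<Longrightarrow>
      val_le S Prop w (greatest_fp S Prop F)"
proof -
  define co where "co v = PropV (\<lambda>s\<in>S. 1 - prop_of v s)" for v :: "'a val"
  have coD: "co v \<in> val_dom S Prop" if "v \<in> val_dom S Prop" for v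
    unfolding co_def using val_dom_PropD[OF that] by (intro val_dom_PropI) auto
  have coco: "co (co v) = v" if "v \<in> val_dom S Prop" for v
    using that by (auto simp: co_def prop_dom_def PiE_def extensional_def fun_eq_iff)
  have co_le: "val_le S Prop (co v) (co w) \<longleftrightarrow> val_le S Prop w v" for v w
    by (auto simp: co_def)
  define G where "G v = co (F (co v))" for v
  have "\<And>v. v \<in> val_dom S Prop \<Longrightarrow> G v \<in> val_dom S Prop"
    "\<And>v w. v \<in> val_dom S Prop \<Longrightarrow> w \<in> val_dom S Prop \<Longrightarrow> val_le S Prop v w \<Longrightarrow>
      val_le S Prop (G v) (G w)"
    unfolding G_def co_le using coD dom mono co_le by blast+
  note l = least_fp_Prop[of S G, OF this]
  define m where "m = co (least_fp S Prop G)"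
  have mD: "m \<in> val_dom S Prop" using coD l(1) by (simp add: m_def del: val_dom.simps)
  have fp: "F m = m"
    using l(2) coco[OF dom[OF mD]] by (simp add: m_def G_def)
  have ge: "val_le S Prop w m" if "w \<in> val_dom S Prop" "val_le S Prop w (F w)" for w
  proof -
    have "val_le S Prop (least_fp S Prop G) (co w)"
      using that coD by (intro l(3)) (simp_all add: G_def coco co_le del: val_le.simps val_dom.simps)
    then have "val_le S Prop (co (co w)) m"
      by (simp add: m_def co_le del: val_le.simps)
    then show ?thesis using coco that(1) by simp
  qed
  have "greatest_fp S Prop F = m"
    using mD fp ge by (intro greatest_fp_eqI) auto
  then show "?g \<in> val_dom S Prop" "F ?g = ?g"
    "\<And>w. w \<in> val_dom S Prop \<Longrightarrow> val_le S Prop w (F w) \<Longrightarrow> val_le S Prop w ?g"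
    using mD fp ge by auto
qed

section \<open>Line chains\<close>

text \<open>Truncated subtraction makes state 0 its own successor. The labeling \<open>L\<close>
  lives on all naturals and is merely cut off at \<open>K\<close>, so chains of different lengths
  can share it.\<close>

definition line_chain :: "('p \<Rightarrow> nat set) \<Rightarrow> nat \<Rightarrow> (nat, 'p) mchain" where
  "line_chain L K = \<lparr>states = {..K}, prob = (\<lambda>i j. if j = i - 1 then 1 else 0),
     label = (\<lambda>p. {..K} \<inter> L p), init = K\<rparr>"

lemma line_chain_simps [simp]:
  "states (line_chain L K) = {..K}" "label (line_chain L K) p = {..K} \<inter> L p"
  "init (line_chain L K) = K"
  by (simp_all add: line_chain_def)

lemma line_chain_succs [simp]: "i \<le> K \<Longrightarrow> succs (line_chain L K) i = {i - 1}"
  by (auto simp: line_chain_def succs_def)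

lemma line_chain_sum [simp]:
  assumes "i \<le> K"
  shows "(\<Sum>j\<le>K. prob (line_chain L K) i j * f j) = f (i - 1)"
proof -
  have "(\<Sum>j\<le>K. prob (line_chain L K) i j * f j) = (\<Sum>j\<le>K. if j = i - 1 then f j else 0)"
    by (intro sum.cong) (auto simp: line_chain_def)
  with assms show ?thesis by auto
qed

lemma markov_chain_line_chain:
  assumes "\<And>p. L (neg p) = - L p"
  shows "markov_chain neg (line_chain L K)"
  using line_chain_sum[of _ K L "\<lambda>_. 1"] assms
  by (auto simp: markov_chain_def line_chain_def)

section \<open>Monotonicity of the real-valued semantics at order zero\<close>

lemma in_bound_mono: "in_bound x J \<Longrightarrow> x \<le> y \<Longrightarrow> in_bound y J"
  by (cases J) auto

lemma in_bound_01: "bound_ok J \<Longrightarrow> in_bound 1 J \<and> \<not> in_bound 0 J"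
  by (cases J) auto

text \<open>At order 0 every type in the derivation is \<open>Prop\<close>, so abstraction and
  application cannot occur. The fixpoint cases retain the typing of the body, because monotonicity
  of the body has to be invoked there.\<close>

lemma order0_induct [consumes 1, case_names Atom Var Or And Thr Box Dia Next Mu Nu]:
  assumes "typed \<Gamma> \<phi> \<tau> 0"
    and "\<And>\<Gamma> p. P \<Gamma> (Atom p)"
    and "\<And>\<Gamma> x. x \<in> dom \<Gamma> \<Longrightarrow> P \<Gamma> (Var x)"
    and "\<And>\<Gamma> \<phi> \<psi>. P \<Gamma> \<phi> \<Longrightarrow> P \<Gamma> \<psi> \<Longrightarrow> P \<Gamma> (Or \<phi> \<psi>)"
    and "\<And>\<Gamma> \<phi> \<psi>. P \<Gamma> \<phi> \<Longrightarrow> P \<Gamma> \<psi> \<Longrightarrow> P \<Gamma> (And \<phi> \<psi>)"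
    and "\<And>\<Gamma> \<phi> J. P \<Gamma> \<phi> \<Longrightarrow> bound_ok J \<Longrightarrow> P \<Gamma> (Thr \<phi> J)"
    and "\<And>\<Gamma> \<phi>. P \<Gamma> \<phi> \<Longrightarrow> P \<Gamma> (Box \<phi>)"
    and "\<And>\<Gamma> \<phi>. P \<Gamma> \<phi> \<Longrightarrow> P \<Gamma> (Dia \<phi>)"
    and "\<And>\<Gamma> \<phi>. P \<Gamma> \<phi> \<Longrightarrow> P \<Gamma> (Next \<phi>)"
    and "\<And>\<Gamma> x \<phi>. typed (\<Gamma>(x \<mapsto> Prop)) \<phi> Prop 0 \<Longrightarrow> P (\<Gamma>(x \<mapsto> Prop)) \<phi> \<Longrightarrow> P \<Gamma> (Mu x \<phi>)"
    and "\<And>\<Gamma> x \<phi>. typed (\<Gamma>(x \<mapsto> Prop)) \<phi> Prop 0 \<Longrightarrow> P (\<Gamma>(x \<mapsto> Prop)) \<phi> \<Longrightarrow> P \<Gamma> (Nu x \<phi>)"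
  shows "P \<Gamma> \<phi>"
proof -
  have Prop: "\<tau> = Prop" if "typed \<Gamma> \<phi> \<tau> 0" for \<Gamma> and \<phi> :: "'a phfl" and \<tau>
    using typed_ord_le[OF that] by (cases \<tau>) auto
  have "typed \<Gamma> \<phi> \<tau> n \<Longrightarrow> n = 0 \<Longrightarrow> P \<Gamma> \<phi>" for n
  proof (induction rule: typed.induct)
    case (mu \<Gamma> x \<tau> \<phi> n)
    then show ?case using Prop[of "\<Gamma>(x \<mapsto> \<tau>)" \<phi> \<tau>] assms(10)[of \<Gamma> x \<phi>] by blast
  next
    case (nu \<Gamma> x \<tau> \<phi> n)
    then show ?case using Prop[of "\<Gamma>(x \<mapsto> \<tau>)" \<phi> \<tau>] assms(11)[of \<Gamma> x \<phi>] by blast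
  next
    case (app \<Gamma> \<phi> \<sigma> \<tau> m \<psi> n)
    then show ?case using Prop[of \<Gamma> \<phi>] by auto
  qed (auto intro: assms(2-9))
  with assms(1) show ?thesis by simp
qed

text \<open>Membership in the domain and monotonicity go through one induction: a fixpoint is known
  to exist only once its body is known to have both properties.\<close>

lemma sem_order0_mono:
  fixes L :: "'p \<Rightarrow> nat set"
  assumes "typed \<Gamma> \<phi> \<tau> 0"
    and "\<And>x. x \<in> dom \<Gamma> \<Longrightarrow> \<rho> x \<in> val_dom {..K} Prop \<and> \<rho>' x \<in> val_dom {..K} Prop \<and>
      val_le {..K} Prop (\<rho> x) (\<rho>' x)"
  shows "sem (line_chain L K) \<phi> Prop \<rho> \<in> val_dom {..K} Prop"
    and "val_le {..K} Prop (sem (line_chain L K) \<phi> Prop \<rho>) (sem (line_chain L K) \<phi> Prop \<rho>')"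
proof -
  let ?D = "val_dom {..K} Prop" and ?le = "val_le {..K} Prop"
  let ?sem = "\<lambda>\<phi>. sem (line_chain L K) \<phi> Prop"
  let ?ok = "\<lambda>\<Gamma> \<rho> \<rho>'. \<forall>x \<in> dom \<Gamma>. \<rho> x \<in> ?D \<and> \<rho>' x \<in> ?D \<and> ?le (\<rho> x) (\<rho>' x)"
  have "\<forall>\<rho> \<rho>'. ?ok \<Gamma> \<rho> \<rho>' \<longrightarrow> ?sem \<phi> \<rho> \<in> ?D \<and> ?le (?sem \<phi> \<rho>) (?sem \<phi> \<rho>')"
    (is "?P \<Gamma> \<phi>")
    using assms(1)
  proof (induction rule: order0_induct)
    case (Atom \<Gamma> p)
    show ?case by (auto simp: prop_dom_def)
  next
    case (Var \<Gamma> x)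
    then show ?case by (auto simp del: val_le.simps val_dom.simps)
  next
    case (Or \<Gamma> \<phi> \<psi>)
    show ?case
    proof (intro allI impI conjI)
      fix \<rho> \<rho>' assume "?ok \<Gamma> \<rho> \<rho>'"
      then have *: "?sem \<phi> \<rho> \<in> ?D" "?sem \<psi> \<rho> \<in> ?D"
        "?le (?sem \<phi> \<rho>) (?sem \<phi> \<rho>')" "?le (?sem \<psi> \<rho>) (?sem \<psi> \<rho>')"
        using Or by blast+
      show "?sem (Or \<phi> \<psi>) \<rho> \<in> ?D"
        using *(1,2)[THEN val_dom_PropD] by (auto intro!: val_dom_PropI simp del: val_dom.simps simp: le_max_iff_disj)
      show "?le (?sem (Or \<phi> \<psi>) \<rho>) (?sem (Or \<phi> \<psi>) \<rho>')"
        using *(3,4) by (simp add: max.coboundedI1 max.coboundedI2)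
    qed
  next
    case (And \<Gamma> \<phi> \<psi>)
    show ?case
    proof (intro allI impI conjI)
      fix \<rho> \<rho>' assume "?ok \<Gamma> \<rho> \<rho>'"
      then have *: "?sem \<phi> \<rho> \<in> ?D" "?sem \<psi> \<rho> \<in> ?D"
        "?le (?sem \<phi> \<rho>) (?sem \<phi> \<rho>')" "?le (?sem \<psi> \<rho>) (?sem \<psi> \<rho>')"
        using And by blast+
      show "?sem (And \<phi> \<psi>) \<rho> \<in> ?D"
        using *(1,2)[THEN val_dom_PropD] by (auto intro!: val_dom_PropI simp del: val_dom.simps simp: min_le_iff_disj)
      show "?le (?sem (And \<phi> \<psi>) \<rho>) (?sem (And \<phi> \<psi>) \<rho>')"
        using *(3,4) by (simp add: min.coboundedI1 min.coboundedI2)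
    qed
  next
    case (Thr \<Gamma> \<phi> J)
    show ?case
    proof (intro allI impI conjI)
      fix \<rho> \<rho>' assume "?ok \<Gamma> \<rho> \<rho>'"
      then have *: "?sem \<phi> \<rho> \<in> ?D" "?le (?sem \<phi> \<rho>) (?sem \<phi> \<rho>')"
        using Thr by blast+
      show "?sem (Thr \<phi> J) \<rho> \<in> ?D"
        using val_dom_PropD[OF *(1)] by (auto intro!: val_dom_PropI simp del: val_dom.simps)
      show "?le (?sem (Thr \<phi> J) \<rho>) (?sem (Thr \<phi> J) \<rho>')"
        using *(2) by (auto intro: in_bound_mono)
    qed
  next
    case (Box \<Gamma> \<phi>)
    show ?case
    proof (intro allI impI conjI)
      fix \<rho> \<rho>' assume "?ok \<Gamma> \<rho> \<rho>'"
      then have *: "?sem \<phi> \<rho> \<in> ?D" "?le (?sem \<phi> \<rho>) (?sem \<phi> \<rho>')"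
        using Box by blast+
      show "?sem (Box \<phi>) \<rho> \<in> ?D"
        using val_dom_PropD[OF *(1)] by (auto intro!: val_dom_PropI simp del: val_dom.simps)
      show "?le (?sem (Box \<phi>) \<rho>) (?sem (Box \<phi>) \<rho>')"
        using *(2) by simp
    qed
  next
    case (Dia \<Gamma> \<phi>)
    show ?case
    proof (intro allI impI conjI)
      fix \<rho> \<rho>' assume "?ok \<Gamma> \<rho> \<rho>'"
      then have *: "?sem \<phi> \<rho> \<in> ?D" "?le (?sem \<phi> \<rho>) (?sem \<phi> \<rho>')"
        using Dia by blast+
      show "?sem (Dia \<phi>) \<rho> \<in> ?D"
        using val_dom_PropD[OF *(1)] by (auto intro!: val_dom_PropI simp del: val_dom.simps)
      show "?le (?sem (Dia \<phi>) \<rho>) (?sem (Dia \<phi>) \<rho>')"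
        using *(2) by simp
    qed
  next
    case (Next \<Gamma> \<phi>)
    show ?case
    proof (intro allI impI conjI)
      fix \<rho> \<rho>' assume "?ok \<Gamma> \<rho> \<rho>'"
      then have *: "?sem \<phi> \<rho> \<in> ?D" "?le (?sem \<phi> \<rho>) (?sem \<phi> \<rho>')"
        using Next by blast+
      show "?sem (Next \<phi>) \<rho> \<in> ?D"
        using val_dom_PropD[OF *(1)] by (auto intro!: val_dom_PropI simp del: val_dom.simps)
      show "?le (?sem (Next \<phi>) \<rho>) (?sem (Next \<phi>) \<rho>')"
        using *(2) by simp
    qed
  next
    case (Mu \<Gamma> x \<phi>)
    show ?case
    proof (intro allI impI)
      fix \<rho> \<rho>' assume ok: "?ok \<Gamma> \<rho> \<rho>'"
      define F where "F \<rho> v = ?sem \<phi> (\<rho>(x := v))" for \<rho> v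
      have IH: "F r v \<in> ?D \<and> ?le (F r v) (F r' w)"
        if "?ok \<Gamma> r r'" "v \<in> ?D" "w \<in> ?D" "?le v w" for r r' v w
      proof -
        have "?ok (\<Gamma>(x \<mapsto> Prop)) (r(x := v)) (r'(x := w))"
          using that by (auto simp del: val_le.simps val_dom.simps)
        with Mu.IH show ?thesis unfolding F_def by blast
      qed
      \<comment> \<open>Equal environments turn the induction hypothesis into monotonicity of a
        single functional in its argument.\<close>
      have okr: "?ok \<Gamma> \<rho> \<rho>" "?ok \<Gamma> \<rho>' \<rho>'" using ok val_le_Prop_refl by blast+
      note l = least_fp_Prop[of "{..K}" "F \<rho>"] and l' = least_fp_Prop[of "{..K}" "F \<rho>'"]
      have l: "least_fp {..K} Prop (F \<rho>) \<in> ?D"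
        "\<And>w. w \<in> ?D \<Longrightarrow> ?le (F \<rho> w) w \<Longrightarrow> ?le (least_fp {..K} Prop (F \<rho>)) w"
        using IH[OF okr(1)] val_le_Prop_refl by (blast intro: l)+
      have l': "least_fp {..K} Prop (F \<rho>') \<in> ?D"
        "F \<rho>' (least_fp {..K} Prop (F \<rho>')) = least_fp {..K} Prop (F \<rho>')"
        using IH[OF okr(2)] val_le_Prop_refl by (blast intro: l')+
      \<comment> \<open>The least fixpoint for the larger environment is a prefixed point of the
        functional for the smaller one.\<close>
      have "?le (least_fp {..K} Prop (F \<rho>)) (least_fp {..K} Prop (F \<rho>'))"
        using IH[OF ok l'(1) l'(1) val_le_Prop_refl] l' by (intro l(2)) auto
      with l(1) show "?sem (Mu x \<phi>) \<rho> \<in> ?D \<and> ?le (?sem (Mu x \<phi>) \<rho>) (?sem (Mu x \<phi>) \<rho>')"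
        by (simp add: F_def[abs_def] del: val_le.simps val_dom.simps)
    qed
  next
    case (Nu \<Gamma> x \<phi>)
    show ?case
    proof (intro allI impI)
      fix \<rho> \<rho>' assume ok: "?ok \<Gamma> \<rho> \<rho>'"
      define F where "F \<rho> v = ?sem \<phi> (\<rho>(x := v))" for \<rho> v
      have IH: "F r v \<in> ?D \<and> ?le (F r v) (F r' w)"
        if "?ok \<Gamma> r r'" "v \<in> ?D" "w \<in> ?D" "?le v w" for r r' v w
      proof -
        have "?ok (\<Gamma>(x \<mapsto> Prop)) (r(x := v)) (r'(x := w))"
          using that by (auto simp del: val_le.simps val_dom.simps)
        with Nu.IH show ?thesis unfolding F_def by blast
      qed
      have okr: "?ok \<Gamma> \<rho> \<rho>" "?ok \<Gamma> \<rho>' \<rho>'" using ok val_le_Prop_refl by blast+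
      note l = greatest_fp_Prop[of "{..K}" "F \<rho>"] and l' = greatest_fp_Prop[of "{..K}" "F \<rho>'"]
      have l: "greatest_fp {..K} Prop (F \<rho>) \<in> ?D"
        "F \<rho> (greatest_fp {..K} Prop (F \<rho>)) = greatest_fp {..K} Prop (F \<rho>)"
        using IH[OF okr(1)] val_le_Prop_refl by (blast intro: l)+
      have l': "\<And>w. w \<in> ?D \<Longrightarrow> ?le w (F \<rho>' w) \<Longrightarrow> ?le w (greatest_fp {..K} Prop (F \<rho>'))"
        using IH[OF okr(2)] val_le_Prop_refl by (blast intro: l')+
      \<comment> \<open>Dually, the greatest fixpoint for the smaller environment is a postfixed
        point of the functional for the larger one.\<close>
      have "?le (greatest_fp {..K} Prop (F \<rho>)) (greatest_fp {..K} Prop (F \<rho>'))"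
        using IH[OF ok l(1) l(1) val_le_Prop_refl] l by (intro l') auto
      with l(1) show "?sem (Nu x \<phi>) \<rho> \<in> ?D \<and> ?le (?sem (Nu x \<phi>) \<rho>) (?sem (Nu x \<phi>) \<rho>')"
        by (simp add: F_def[abs_def] del: val_le.simps val_dom.simps)
    qed
  qed
  with assms(2) show "?sem \<phi> \<rho> \<in> ?D" "?le (?sem \<phi> \<rho>) (?sem \<phi> \<rho>')" by blast+
qed

section \<open>Boolean semantics of order-zero formulas on line chains\<close>

text \<open>If \<open>F\<close> is monotone and \<open>F v i\<close> depends only on \<open>v\<close> up to \<open>i\<close>, then \<open>local_fix F False\<close> is
  the least and \<open>local_fix F True\<close> the greatest fixpoint of \<open>F\<close>: a monotone \<open>f :: bool \<Rightarrow> bool\<close> has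
  the extremal fixpoints \<open>f False\<close> and \<open>f True\<close>.\<close>

fun local_fix :: "((nat \<Rightarrow> bool) \<Rightarrow> nat \<Rightarrow> bool) \<Rightarrow> bool \<Rightarrow> nat \<Rightarrow> bool" where
  "local_fix F b i = F (\<lambda>j. if j < i then local_fix F b j else b) i"

declare local_fix.simps [simp del]

text \<open>\<open>Thr\<close> acts as the identity because an admissible bound accepts 1 and
  rejects 0. The constant clauses for \<open>Lam\<close> and \<open>App\<close> are dummies, chosen
  so that monotonicity holds for untyped formulas as well.\<close>

primrec bsem :: "('p \<Rightarrow> nat set) \<Rightarrow> 'p phfl \<Rightarrow> (nat \<Rightarrow> nat \<Rightarrow> bool) \<Rightarrow> nat \<Rightarrow> bool" where
  "bsem L (Atom p) \<rho> = (\<lambda>i. i \<in> L p)"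
| "bsem L (Var x) \<rho> = \<rho> x"
| "bsem L (Or \<phi> \<psi>) \<rho> = (\<lambda>i. bsem L \<phi> \<rho> i \<or> bsem L \<psi> \<rho> i)"
| "bsem L (And \<phi> \<psi>) \<rho> = (\<lambda>i. bsem L \<phi> \<rho> i \<and> bsem L \<psi> \<rho> i)"
| "bsem L (Thr \<phi> J) \<rho> = bsem L \<phi> \<rho>"
| "bsem L (Box \<phi>) \<rho> = (\<lambda>i. bsem L \<phi> \<rho> (i - 1))"
| "bsem L (Dia \<phi>) \<rho> = (\<lambda>i. bsem L \<phi> \<rho> (i - 1))"
| "bsem L (Next \<phi>) \<rho> = (\<lambda>i. bsem L \<phi> \<rho> (i - 1))"
| "bsem L (Mu x \<phi>) \<rho> = local_fix (\<lambda>v. bsem L \<phi> (\<rho>(x := v))) False"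
| "bsem L (Nu x \<phi>) \<rho> = local_fix (\<lambda>v. bsem L \<phi> (\<rho>(x := v))) True"
| "bsem L (Lam x \<phi>) \<rho> = (\<lambda>i. False)"
| "bsem L (App \<phi> \<psi>) \<rho> = (\<lambda>i. False)"

lemma local_fix_mono:
  assumes "\<And>v w k. k \<le> i \<Longrightarrow> (\<And>j. j \<le> k \<Longrightarrow> v j \<Longrightarrow> w j) \<Longrightarrow> F v k \<Longrightarrow> G w k"
    and "local_fix F b i"
  shows "local_fix G b i"
proof -
  have "k \<le> i \<Longrightarrow> local_fix F b k \<Longrightarrow> local_fix G b k" for k
  proof (induction k rule: less_induct)
    case (less k)
    show ?case
      by (subst local_fix.simps, rule assms(1)[OF less.prems(1) _ less.prems(2)[unfolded local_fix.simps[of F b k]]])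
        (use less.IH less.prems(1) in \<open>auto split: if_splits\<close>)
  qed
  with assms(2) show ?thesis by simp
qed

text \<open>At \<open>i\<close>, the fixpoint and the approximant that defines its value agree below
  \<open>i\<close>. If the value is \<open>b\<close>, they agree at \<open>i\<close> too. Otherwise
  the fixpoint deviates from \<open>b\<close> in the direction of the value already computed, and
  monotonicity keeps that value.\<close>

lemma local_fix_fixpoint:
  assumes mono: "\<And>v w i. (\<And>j. j \<le> i \<Longrightarrow> v j \<Longrightarrow> w j) \<Longrightarrow> F v i \<Longrightarrow> F w i"
  shows "F (local_fix F b) = local_fix F b"
proof
  fix i
  let ?u = "local_fix F b" and ?v = "\<lambda>j. if j < i then local_fix F b j else b"
  have u: "?u i = F ?v i" by (rule local_fix.simps)
  show "F ?u i = ?u i"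
  proof (cases "?u i = b")
    case True
    then have "\<And>j. j \<le> i \<Longrightarrow> ?v j = ?u j" by (auto simp: le_less)
    then show ?thesis unfolding u by (metis (no_types, lifting) mono)
  next
    case False
    show ?thesis
    proof (cases b)
      case True
      then have "\<And>j. j \<le> i \<Longrightarrow> ?u j \<Longrightarrow> ?v j" by auto
      with mono[of i ?u ?v] False True u show ?thesis by blast
    next
      case b: False
      then have "\<And>j. j \<le> i \<Longrightarrow> ?v j \<Longrightarrow> ?u j" by (auto split: if_splits)
      with mono[of i ?v ?u] False b u show ?thesis by blast
    qed
  qed
qed

text \<open>Monotonicity and locality in one statement: modalities look only towards 0, so the value
  at \<open>i\<close> depends on the environment up to \<open>i\<close>. This is what makes
  \<open>local_fix\<close> compute fixpoints.\<close>

lemma bsem_mono: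
  "(\<And>x j. j \<le> i \<Longrightarrow> \<rho> x j \<Longrightarrow> \<rho>' x j) \<Longrightarrow> bsem L \<phi> \<rho> i \<Longrightarrow> bsem L \<phi> \<rho>' i"
proof (induction \<phi> arbitrary: \<rho> \<rho>' i)
  case (Mu x \<phi>)
  show ?case
    unfolding bsem.simps
    by (rule local_fix_mono[OF _ Mu.prems(2)[unfolded bsem.simps]])
      (erule Mu.IH[rotated], use Mu.prems(1) in auto)
next
  case (Nu x \<phi>)
  show ?case
    unfolding bsem.simps
    by (rule local_fix_mono[OF _ Nu.prems(2)[unfolded bsem.simps]])
      (erule Nu.IH[rotated], use Nu.prems(1) in auto)
next
  case (Or \<phi> \<psi>)
  then show ?case by (metis bsem.simps(3))
next
  case (And \<phi> \<psi>)
  then show ?case by (metis bsem.simps(4))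
next
  case (Box \<phi>)
  show ?case using Box.IH[of "i - 1" \<rho> \<rho>'] Box.prems by auto
next
  case (Dia \<phi>)
  show ?case using Dia.IH[of "i - 1" \<rho> \<rho>'] Dia.prems by auto
next
  case (Next \<phi>)
  show ?case using Next.IH[of "i - 1" \<rho> \<rho>'] Next.prems by auto
next
  case (Thr \<phi> J)
  show ?case using Thr.IH[of i \<rho> \<rho>'] Thr.prems by auto
qed auto

lemma bsem_mono_upd:
  "(\<And>j. j \<le> i \<Longrightarrow> v j \<Longrightarrow> w j) \<Longrightarrow> bsem L \<phi> (\<rho>(x := v)) i \<Longrightarrow> bsem L \<phi> (\<rho>(x := w)) i"
  by (rule bsem_mono[of i "\<rho>(x := v)"]) auto

section \<open>Agreement of the real-valued and the Boolean semantics\<close>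

definition bool_val :: "nat \<Rightarrow> (nat \<Rightarrow> bool) \<Rightarrow> nat val" where
  "bool_val K u = PropV (\<lambda>i\<in>{..K}. if u i then 1 else 0)"

lemma bool_val_dom: "bool_val K u \<in> val_dom {..K} Prop"
  unfolding bool_val_def by (rule val_dom_PropI) auto

lemma prop_of_bool_val [simp]: "i \<le> K \<Longrightarrow> prop_of (bool_val K u) i = (if u i then 1 else 0)"
  by (simp add: bool_val_def)

text \<open>Each operator preserves 0-1 values on a line chain. For fixpoints, the Boolean solution
  must be extremal among all \<open>[0,1]\<close>-valued fixpoints, which is shown by induction
  along the states.\<close>

lemma sem_eq_bsem:
  assumes "typed \<Gamma> \<phi> \<tau> 0" and "\<And>x. x \<in> dom \<Gamma> \<Longrightarrow> \<rho> x = bool_val K (\<beta> x)"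
  shows "sem (line_chain L K) \<phi> Prop \<rho> = bool_val K (bsem L \<phi> \<beta>)"
proof -
  let ?D = "val_dom {..K} Prop"
  let ?sem = "\<lambda>\<phi>. sem (line_chain L K) \<phi> Prop"
  have mono: "val_le {..K} Prop (?sem \<phi> (\<rho>(x := v))) (?sem \<phi> (\<rho>(x := w)))"
    if "typed (\<Gamma>(x \<mapsto> Prop)) \<phi> Prop 0" "\<forall>x\<in>dom \<Gamma>. \<rho> x = bool_val K (\<beta> x)"
      "v \<in> ?D" "w \<in> ?D" "val_le {..K} Prop v w" for \<Gamma> \<phi> \<rho> \<beta> x v w
    by (rule sem_order0_mono(2)[OF that(1)])
      (use that(3-) bool_val_dom val_le_Prop_refl in
        \<open>auto simp: that(2)[THEN bspec, OF domI] simp del: val_le.simps val_dom.simps\<close>)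
  have "\<forall>\<rho> \<beta>. (\<forall>x\<in>dom \<Gamma>. \<rho> x = bool_val K (\<beta> x)) \<longrightarrow> ?sem \<phi> \<rho> = bool_val K (bsem L \<phi> \<beta>)"
    using assms(1)
  proof (induction rule: order0_induct)
    case (Atom \<Gamma> p)
    show ?case by (auto simp: bool_val_def intro!: restrict_ext)
  next
    case (Var \<Gamma> x)
    then show ?case by auto
  next
    case (Or \<Gamma> \<phi> \<psi>)
    show ?case
    proof (intro allI impI)
      fix \<rho> \<beta> assume "\<forall>x\<in>dom \<Gamma>. \<rho> x = bool_val K (\<beta> x)"
      then have "?sem \<phi> \<rho> = bool_val K (bsem L \<phi> \<beta>)" "?sem \<psi> \<rho> = bool_val K (bsem L \<psi> \<beta>)"
        using Or by blast+
      then show "?sem (Or \<phi> \<psi>) \<rho> = bool_val K (bsem L (Or \<phi> \<psi>) \<beta>)"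
        by (auto simp: bool_val_def intro!: restrict_ext)
    qed
  next
    case (And \<Gamma> \<phi> \<psi>)
    show ?case
    proof (intro allI impI)
      fix \<rho> \<beta> assume "\<forall>x\<in>dom \<Gamma>. \<rho> x = bool_val K (\<beta> x)"
      then have "?sem \<phi> \<rho> = bool_val K (bsem L \<phi> \<beta>)" "?sem \<psi> \<rho> = bool_val K (bsem L \<psi> \<beta>)"
        using And by blast+
      then show "?sem (And \<phi> \<psi>) \<rho> = bool_val K (bsem L (And \<phi> \<psi>) \<beta>)"
        by (auto simp: bool_val_def intro!: restrict_ext)
    qed
  next
    case (Thr \<Gamma> \<phi> J)
    show ?case
    proof (intro allI impI)
      fix \<rho> \<beta> assume "\<forall>x\<in>dom \<Gamma>. \<rho> x = bool_val K (\<beta> x)"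
      then have "?sem \<phi> \<rho> = bool_val K (bsem L \<phi> \<beta>)"
        using Thr by blast
      then show "?sem (Thr \<phi> J) \<rho> = bool_val K (bsem L (Thr \<phi> J) \<beta>)"
        using in_bound_01[OF Thr(2)] by (auto simp: bool_val_def intro!: restrict_ext)
    qed
  next
    case (Box \<Gamma> \<phi>)
    show ?case
    proof (intro allI impI)
      fix \<rho> \<beta> assume "\<forall>x\<in>dom \<Gamma>. \<rho> x = bool_val K (\<beta> x)"
      then have "?sem \<phi> \<rho> = bool_val K (bsem L \<phi> \<beta>)"
        using Box by blast
      then show "?sem (Box \<phi>) \<rho> = bool_val K (bsem L (Box \<phi>) \<beta>)"
        by (auto simp: bool_val_def intro!: restrict_ext)
    qed
  next
    case (Dia \<Gamma> \<phi>)
    show ?case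
    proof (intro allI impI)
      fix \<rho> \<beta> assume "\<forall>x\<in>dom \<Gamma>. \<rho> x = bool_val K (\<beta> x)"
      then have "?sem \<phi> \<rho> = bool_val K (bsem L \<phi> \<beta>)"
        using Dia by blast
      then show "?sem (Dia \<phi>) \<rho> = bool_val K (bsem L (Dia \<phi>) \<beta>)"
        by (auto simp: bool_val_def intro!: restrict_ext)
    qed
  next
    case (Next \<Gamma> \<phi>)
    show ?case
    proof (intro allI impI)
      fix \<rho> \<beta> assume "\<forall>x\<in>dom \<Gamma>. \<rho> x = bool_val K (\<beta> x)"
      then have "?sem \<phi> \<rho> = bool_val K (bsem L \<phi> \<beta>)"
        using Next by blast
      then show "?sem (Next \<phi>) \<rho> = bool_val K (bsem L (Next \<phi>) \<beta>)"
        by (auto simp: bool_val_def intro!: restrict_ext)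
    qed
  next
    case (Mu \<Gamma> x \<phi>)
    show ?case
    proof (intro allI impI)
      fix \<rho> \<beta> assume ok: "\<forall>x\<in>dom \<Gamma>. \<rho> x = bool_val K (\<beta> x)"
      define u where "u = local_fix (\<lambda>v. bsem L \<phi> (\<beta>(x := v))) False"
      have IH: "?sem \<phi> (\<rho>(x := bool_val K v)) = bool_val K (bsem L \<phi> (\<beta>(x := v)))" for v
        using ok by (intro Mu.IH[rule_format]) auto
      have "least_fp {..K} Prop (\<lambda>v. ?sem \<phi> (\<rho>(x := v))) = bool_val K u"
      proof (rule least_fp_eqI)
        show "?sem \<phi> (\<rho>(x := bool_val K u)) = bool_val K u"
          unfolding IH u_def by (subst local_fix_fixpoint) (auto elim: bsem_mono_upd[rotated])
      next
        fix w assume w: "w \<in> ?D" "?sem \<phi> (\<rho>(x := w)) = w"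
        \<comment> \<open>The competitor \<open>w\<close> may take intermediate values. By induction
          the approximant \<open>?v\<close> defining \<open>u i\<close> lies below \<open>w\<close>;
          applying the monotone body and \<open>w\<close>'s fixpoint equation carries the bound to
          state \<open>i\<close>.\<close>
        have "i \<le> K \<Longrightarrow> u i \<Longrightarrow> 1 \<le> prop_of w i" for i
        proof (induction i rule: less_induct)
          case (less i)
          let ?v = "\<lambda>j. if j < i then u j else False"
          have "val_le {..K} Prop (bool_val K ?v) w"
            using less.IH val_dom_PropD[OF w(1)] by auto
          from mono[OF Mu.hyps ok bool_val_dom w(1) this]
          have "val_le {..K} Prop (bool_val K (bsem L \<phi> (\<beta>(x := ?v)))) w"
            unfolding IH w(2) .
          moreover have "bsem L \<phi> (\<beta>(x := ?v)) i"
            using less.prems(2) unfolding u_def by (subst (asm) local_fix.simps)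
          ultimately show ?case
            using less.prems(1) unfolding val_le.simps by (auto dest!: bspec[of _ _ i])
        qed
        then show "val_le {..K} Prop (bool_val K u) w"
          using val_dom_PropD[OF w(1)] by auto
      qed (rule bool_val_dom)
      then show "?sem (Mu x \<phi>) \<rho> = bool_val K (bsem L (Mu x \<phi>) \<beta>)" by (simp add: u_def)
    qed
  next
    case (Nu \<Gamma> x \<phi>)
    show ?case
    proof (intro allI impI)
      fix \<rho> \<beta> assume ok: "\<forall>x\<in>dom \<Gamma>. \<rho> x = bool_val K (\<beta> x)"
      define u where "u = local_fix (\<lambda>v. bsem L \<phi> (\<beta>(x := v))) True"
      have IH: "?sem \<phi> (\<rho>(x := bool_val K v)) = bool_val K (bsem L \<phi> (\<beta>(x := v)))" for v
        using ok by (intro Nu.IH[rule_format]) auto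
      have "greatest_fp {..K} Prop (\<lambda>v. ?sem \<phi> (\<rho>(x := v))) = bool_val K u"
      proof (rule greatest_fp_eqI)
        show "?sem \<phi> (\<rho>(x := bool_val K u)) = bool_val K u"
          unfolding IH u_def by (subst local_fix_fixpoint) (auto elim: bsem_mono_upd[rotated])
      next
        fix w assume w: "w \<in> ?D" "?sem \<phi> (\<rho>(x := w)) = w"
        have "i \<le> K \<Longrightarrow> \<not> u i \<Longrightarrow> prop_of w i \<le> 0" for i
        proof (induction i rule: less_induct)
          case (less i)
          let ?v = "\<lambda>j. if j < i then u j else True"
          have "val_le {..K} Prop w (bool_val K ?v)"
            using less.IH val_dom_PropD[OF w(1)] by auto
          from mono[OF Nu.hyps ok w(1) bool_val_dom this]
          have "val_le {..K} Prop w (bool_val K (bsem L \<phi> (\<beta>(x := ?v))))"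
            unfolding IH w(2) .
          moreover have "\<not> bsem L \<phi> (\<beta>(x := ?v)) i"
            using less.prems(2) unfolding u_def by (subst (asm) local_fix.simps)
          ultimately show ?case
            using less.prems(1) unfolding val_le.simps by (auto dest!: bspec[of _ _ i])
        qed
        then show "val_le {..K} Prop w (bool_val K u)"
          using val_dom_PropD[OF w(1)] by auto
      qed (rule bool_val_dom)
      then show "?sem (Nu x \<phi>) \<rho> = bool_val K (bsem L (Nu x \<phi>) \<beta>)" by (simp add: u_def)
    qed
  qed
  with assms(2) show ?thesis by blast
qed

lemma models_line_chain_iff:
  assumes "closed_prop 0 \<phi>"
  shows "models (line_chain L K) \<phi> \<longleftrightarrow> bsem L \<phi> \<beta> K"
  using sem_eq_bsem[of Map.empty \<phi> Prop "\<lambda>_. undefined" K \<beta> L] assms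
  by (simp add: models_def closed_prop_def)

section \<open>Finitely many profiles\<close>

text \<open>Bound variables are interpreted by the completed fixpoint rather than by its
  approximants, so each modality contributes exactly one bit.\<close>

primrec profile :: "('p \<Rightarrow> nat set) \<Rightarrow> 'p phfl \<Rightarrow> (nat \<Rightarrow> nat \<Rightarrow> bool) \<Rightarrow> nat \<Rightarrow> bool list" where
  "profile L (Atom p) \<rho> i = []"
| "profile L (Var x) \<rho> i = []"
| "profile L (Or \<phi> \<psi>) \<rho> i = profile L \<phi> \<rho> i @ profile L \<psi> \<rho> i"
| "profile L (And \<phi> \<psi>) \<rho> i = profile L \<phi> \<rho> i @ profile L \<psi> \<rho> i"
| "profile L (Thr \<phi> J) \<rho> i = profile L \<phi> \<rho> i"
| "profile L (Box \<phi>) \<rho> i = bsem L \<phi> \<rho> i # profile L \<phi> \<rho> i"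
| "profile L (Dia \<phi>) \<rho> i = bsem L \<phi> \<rho> i # profile L \<phi> \<rho> i"
| "profile L (Next \<phi>) \<rho> i = bsem L \<phi> \<rho> i # profile L \<phi> \<rho> i"
| "profile L (Mu x \<phi>) \<rho> i = profile L \<phi> (\<rho>(x := bsem L (Mu x \<phi>) \<rho>)) i"
| "profile L (Nu x \<phi>) \<rho> i = profile L \<phi> (\<rho>(x := bsem L (Nu x \<phi>) \<rho>)) i"
| "profile L (Lam x \<phi>) \<rho> i = []"
| "profile L (App \<phi> \<psi>) \<rho> i = []"

text \<open>The length depends on the formula alone. This bounds the number of profiles and lets
  equal concatenations be split into equal parts.\<close>

lemma length_profile: "length (profile L \<phi> \<rho> i) = length (profile L' \<phi> \<rho>' i')"
proof (induction \<phi> arbitrary: \<rho> \<rho>')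
  case (Or \<phi> \<psi>)
  then show ?case by (metis length_append profile.simps(3))
next
  case (And \<phi> \<psi>)
  then show ?case by (metis length_append profile.simps(4))
qed (simp_all del: bsem.simps)

lemma bsem_cong:
  assumes "\<And>x j. j \<le> i \<Longrightarrow> \<rho> x j = \<rho>' x j"
  shows "bsem L \<phi> \<rho> i = bsem L \<phi> \<rho>' i"
  using bsem_mono[of i \<rho> \<rho>' L \<phi>] bsem_mono[of i \<rho>' \<rho> L \<phi>] assms by auto

lemma profile_cong:
  "(\<And>x j. j \<le> i \<Longrightarrow> \<rho> x j = \<rho>' x j) \<Longrightarrow> profile L \<phi> \<rho> i = profile L \<phi> \<rho>' i"
proof (induction \<phi> arbitrary: \<rho> \<rho>')
  case (Mu x \<phi>)
  have "bsem L (Mu x \<phi>) \<rho> j = bsem L (Mu x \<phi>) \<rho>' j" if "j \<le> i" for j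
    using Mu.prems that by (intro bsem_cong) auto
  then show ?case unfolding profile.simps using Mu.prems by (intro Mu.IH) auto
next
  case (Nu x \<phi>)
  have "bsem L (Nu x \<phi>) \<rho> j = bsem L (Nu x \<phi>) \<rho>' j" if "j \<le> i" for j
    using Nu.prems that by (intro bsem_cong) auto
  then show ?case unfolding profile.simps using Nu.prems by (intro Nu.IH) auto
next
  case (Or \<phi> \<psi>)
  from Or.IH(1,2)[OF Or.prems] show ?case by simp
next
  case (And \<phi> \<psi>)
  from And.IH(1,2)[OF And.prems] show ?case by simp
next
  case (Box \<phi>)
  from Box.IH[OF Box.prems] bsem_cong[OF Box.prems] show ?case by simp
next
  case (Dia \<phi>)
  from Dia.IH[OF Dia.prems] bsem_cong[OF Dia.prems] show ?case by simp
next
  case (Next \<phi>)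
  from Next.IH[OF Next.prems] bsem_cong[OF Next.prems] show ?case by simp
next
  case (Thr \<phi> J)
  from Thr.IH[OF Thr.prems] show ?case by simp
qed auto

text \<open>Both sides unfold to approximants that follow their fixpoints up to \<open>i\<close> and
  \<open>i'\<close> and share the default \<open>b\<close> at the next position.\<close>

lemma local_fix_step:
  assumes "\<And>v v'. (\<And>j. j \<le> i \<Longrightarrow> v j = local_fix (\<lambda>v. bsem L \<phi> (\<rho>(x := v))) b j) \<Longrightarrow>
      (\<And>j. j \<le> i' \<Longrightarrow> v' j = local_fix (\<lambda>v. bsem L' \<phi> (\<rho>'(x := v))) b j) \<Longrightarrow>
      v (Suc i) = v' (Suc i') \<Longrightarrow>
      bsem L \<phi> (\<rho>(x := v)) (Suc i) = bsem L' \<phi> (\<rho>'(x := v')) (Suc i')"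
  shows "local_fix (\<lambda>v. bsem L \<phi> (\<rho>(x := v))) b (Suc i) =
    local_fix (\<lambda>v. bsem L' \<phi> (\<rho>'(x := v))) b (Suc i')"
  by (subst (1 2) local_fix.simps, rule assms) auto

text \<open>One transition of a deterministic finite automaton: a modality at the new state reads
  its stored bit, and everything else is computed from the labels and variable values there. The two
  positions may lie in different words.\<close>

lemma profile_step:
  assumes "\<And>p. Suc i \<in> L p \<longleftrightarrow> Suc i' \<in> L' p"
  shows "profile L \<phi> \<rho> i = profile L' \<phi> \<rho>' i' \<Longrightarrow> (\<And>x. \<rho> x (Suc i) = \<rho>' x (Suc i')) \<Longrightarrow>
    bsem L \<phi> \<rho> (Suc i) = bsem L' \<phi> \<rho>' (Suc i') \<and>
    profile L \<phi> \<rho> (Suc i) = profile L' \<phi> \<rho>' (Suc i')"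
proof (induction \<phi> arbitrary: \<rho> \<rho>')
  case (Or \<phi> \<psi>)
  then have "profile L \<phi> \<rho> i = profile L' \<phi> \<rho>' i'" "profile L \<psi> \<rho> i = profile L' \<psi> \<rho>' i'"
    using length_profile[of L \<phi> \<rho> i L' \<rho>' i'] by auto
  with Or.IH Or.prems(2) show ?case by (metis bsem.simps(3) profile.simps(3))
next
  case (And \<phi> \<psi>)
  then have "profile L \<phi> \<rho> i = profile L' \<phi> \<rho>' i'" "profile L \<psi> \<rho> i = profile L' \<psi> \<rho>' i'"
    using length_profile[of L \<phi> \<rho> i L' \<rho>' i'] by auto
  with And.IH And.prems(2) show ?case by (metis bsem.simps(4) profile.simps(4))
next
  case (Mu x \<phi>)
  let ?u = "bsem L (Mu x \<phi>) \<rho>" and ?u' = "bsem L' (Mu x \<phi>) \<rho>'"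
  \<comment> \<open>Leaving the new position free allows two uses: with the approximants, to get the
    fixpoint's value there, and then with the fixpoint itself, to get its profile.\<close>
  have IH: "bsem L \<phi> (\<rho>(x := v)) (Suc i) = bsem L' \<phi> (\<rho>'(x := v')) (Suc i') \<and>
     profile L \<phi> (\<rho>(x := v)) (Suc i) = profile L' \<phi> (\<rho>'(x := v')) (Suc i')"
    if v: "\<And>j. j \<le> i \<Longrightarrow> v j = ?u j" "\<And>j. j \<le> i' \<Longrightarrow> v' j = ?u' j" "v (Suc i) = v' (Suc i')" for v v'
  proof (rule Mu.IH)
    have "profile L \<phi> (\<rho>(x := v)) i = profile L \<phi> (\<rho>(x := ?u)) i"
      "profile L' \<phi> (\<rho>'(x := v')) i' = profile L' \<phi> (\<rho>'(x := ?u')) i'"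
      using v by (auto intro!: profile_cong simp del: bsem.simps)
    with Mu.prems(1) show "profile L \<phi> (\<rho>(x := v)) i = profile L' \<phi> (\<rho>'(x := v')) i'" by simp
  qed (use Mu.prems(2) v(3) in auto)
  then have "?u (Suc i) = ?u' (Suc i')"
    unfolding bsem.simps by (intro local_fix_step) blast
  with IH[of ?u ?u'] show ?case by (simp del: bsem.simps)
next
  case (Nu x \<phi>)
  let ?u = "bsem L (Nu x \<phi>) \<rho>" and ?u' = "bsem L' (Nu x \<phi>) \<rho>'"
  have IH: "bsem L \<phi> (\<rho>(x := v)) (Suc i) = bsem L' \<phi> (\<rho>'(x := v')) (Suc i') \<and>
     profile L \<phi> (\<rho>(x := v)) (Suc i) = profile L' \<phi> (\<rho>'(x := v')) (Suc i')"
    if v: "\<And>j. j \<le> i \<Longrightarrow> v j = ?u j" "\<And>j. j \<le> i' \<Longrightarrow> v' j = ?u' j" "v (Suc i) = v' (Suc i')" for v v'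
  proof (rule Nu.IH)
    have "profile L \<phi> (\<rho>(x := v)) i = profile L \<phi> (\<rho>(x := ?u)) i"
      "profile L' \<phi> (\<rho>'(x := v')) i' = profile L' \<phi> (\<rho>'(x := ?u')) i'"
      using v by (auto intro!: profile_cong simp del: bsem.simps)
    with Nu.prems(1) show "profile L \<phi> (\<rho>(x := v)) i = profile L' \<phi> (\<rho>'(x := v')) i'" by simp
  qed (use Nu.prems(2) v(3) in auto)
  then have "?u (Suc i) = ?u' (Suc i')"
    unfolding bsem.simps by (intro local_fix_step) blast
  with IH[of ?u ?u'] show ?case by (simp del: bsem.simps)
qed (use assms in auto)

section \<open>The order-one formula\<close>

text \<open>\<open>Var 0\<close> is the recursive function and \<open>Var 1\<close> its argument.
  Each \<open>p\<close> passed adds one \<open>Next\<close> to the argument, which is finally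
  evaluated at the first \<open>q\<close>.\<close>

definition compare_fun :: "'p \<Rightarrow> 'p \<Rightarrow> 'p phfl" where
  "compare_fun p q = Mu 0 (Lam 1 (Or (And (Atom q) (Var 1))
     (And (Atom p) (Next (App (Var 0) (Next (Var 1)))))))"

definition compare_formula :: "'p \<Rightarrow> 'p \<Rightarrow> 'p phfl" where
  "compare_formula p q = App (compare_fun p q) (Atom p)"

lemma closed_compare_formula: "closed_prop 1 (compare_formula p q)"
proof -
  let ?G = "[0 \<mapsto> Arr Prop Prop, 1 \<mapsto> Prop] :: nat \<rightharpoonup> ty"
  have F: "typed ?G (Var 0) (Arr Prop Prop) 1" and X: "typed ?G (Var 1) Prop 0"
    using typed.var[of ?G 0 "Arr Prop Prop"] typed.var[of ?G 1 Prop] by simp_all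
  have "typed ?G (Or (And (Atom q) (Var 1)) (And (Atom p) (Next (App (Var 0) (Next (Var 1))))))
      Prop (max (max 0 0) (max 0 (max 1 0)))"
    by (rule typed.disj[OF typed.conj[OF typed.atom X]
          typed.conj[OF typed.atom typed.nxt[OF typed.app[OF F typed.nxt[OF X]]]]])
  from typed.app[OF typed.mu[OF typed.lam[OF this]] typed.atom[of _ p]]
  show ?thesis by (simp add: closed_prop_def compare_formula_def compare_fun_def)
qed

text \<open>Closed form of the least fixpoint denoted by \<open>compare_fun\<close>. The value at 0
  is 0 because the recursion unfolds forever in the \<open>p\<close>-loop.\<close>

primrec compare_val :: "nat set \<Rightarrow> (nat \<Rightarrow> real) \<Rightarrow> nat \<Rightarrow> real" where
  "compare_val A v 0 = 0"
| "compare_val A v (Suc i) =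
     (if Suc i \<in> A then compare_val A (\<lambda>j. v (j - 1)) i else v (Suc i))"

lemma compare_val_mono:
  "(\<And>j. j \<le> i \<Longrightarrow> v j \<le> w j) \<Longrightarrow> compare_val A v i \<le> compare_val A w i"
  by (induction i arbitrary: v w) auto

lemma compare_val_cong:
  "(\<And>j. j \<le> i \<Longrightarrow> v j = w j) \<Longrightarrow> compare_val A v i = compare_val A w i"
  by (intro order_antisym compare_val_mono) auto

lemma compare_val_bounds:
  "(\<And>j. j \<le> i \<Longrightarrow> 0 \<le> v j \<and> v j \<le> 1) \<Longrightarrow> 0 \<le> compare_val A v i \<and> compare_val A v i \<le> 1"
  by (induction i arbitrary: v) auto

text \<open>Every state above \<open>m\<close> shifts the argument once towards 0. Truncated
  subtraction matches the loop: for \<open>m \<le> n\<close> the argument is read at state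
  0.\<close>

lemma compare_val_prefix:
  assumes "m > 0" "m \<notin> A" "\<And>i. m < i \<Longrightarrow> i \<in> A"
  shows "compare_val A v (m + n) = v (m - n)"
proof (induction n arbitrary: v)
  case 0
  with assms show ?case by (cases m) auto
next
  case (Suc n)
  with assms(3)[of "Suc (m + n)"] show ?case by simp
qed

text \<open>The closed form satisfies the fixpoint equation and lies below any other solution by
  induction on the state, since the equation at \<open>Suc i\<close> refers back only to
  \<open>i\<close>.\<close>

lemma sem_compare_fun:
  assumes "L q = - L p" "0 \<in> L p"
  shows "sem (line_chain L K) (compare_fun p q) (Arr Prop Prop) \<rho> =
    FunV (\<lambda>v\<in>prop_dom {..K}. PropV (\<lambda>i\<in>{..K}. compare_val (L p) v i))"
proof -
  define c where "c = FunV (\<lambda>v\<in>prop_dom {..K}. PropV (\<lambda>i\<in>{..K}. compare_val (L p) v i))"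
  \<comment> \<open>This is the denotation of \<open>Next (Var 1)\<close>. Restricting it keeps it
    in \<open>prop_dom\<close>, while \<open>compare_val\<close> shifts without restriction;
    \<open>compare_val_cong\<close> bridges the two.\<close>
  define shift :: "(nat \<Rightarrow> real) \<Rightarrow> nat \<Rightarrow> real" where "shift v = (\<lambda>i\<in>{..K}. v (i - 1))" for v
  have shift: "shift v \<in> prop_dom {..K}" if "v \<in> prop_dom {..K}" for v
    using that by (auto simp: prop_dom_def shift_def PiE_iff)
  define F where "F w = FunV (\<lambda>v\<in>prop_dom {..K}. PropV (\<lambda>i\<in>{..K}.
    max (min (if i \<in> L q then 1 else 0) (v i))
      (min (if i \<in> L p then 1 else 0) (prop_of (fun_of w (shift v)) (i - 1)))))" for w
  have F: "sem (line_chain L K) (Lam 1 (Or (And (Atom q) (Var 1))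
     (And (Atom p) (Next (App (Var 0) (Next (Var 1))))))) (Arr Prop Prop) (\<rho>(0 := w)) = F w" for w
    by (auto simp: F_def shift_def cong: restrict_cong intro!: restrict_ext)
  have bounds: "0 \<le> compare_val (L p) v i \<and> compare_val (L p) v i \<le> 1"
    if "v \<in> prop_dom {..K}" "i \<le> K" for v i
    using that by (intro compare_val_bounds) (auto simp: prop_dom_def PiE_iff)
  have "least_fp {..K} (Arr Prop Prop) F = c"
  proof (rule least_fp_eqI)
    have "(\<lambda>v\<in>prop_dom {..K}. PropV (\<lambda>i\<in>{..K}. compare_val (L p) v i))
        \<in> prop_dom {..K} \<rightarrow>\<^sub>E val_dom {..K} Prop"
      using bounds by (auto intro!: val_dom_PropI simp del: val_dom.simps)
    then show "c \<in> val_dom {..K} (Arr Prop Prop)"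
      unfolding c_def val_dom.simps(2)
      by (intro imageI CollectI conjI ballI impI) (auto intro: compare_val_mono)
  next
    have "max (min (if i \<in> L q then 1 else 0) (v i)) (min (if i \<in> L p then 1 else 0)
        (prop_of (fun_of c (shift v)) (i - 1))) = compare_val (L p) v i"
      if v: "v \<in> prop_dom {..K}" and i: "i \<le> K" for v i
    proof -
      have "fun_of c (shift v) = PropV (\<lambda>i\<in>{..K}. compare_val (L p) (shift v) i)"
        using shift[OF v] by (simp add: c_def)
      moreover have "compare_val (L p) (shift v) j = compare_val (L p) (\<lambda>j. v (j - 1)) j"
        if "j \<le> K" for j
        using that by (intro compare_val_cong) (simp add: shift_def)
      moreover have "0 \<le> v i" "v i \<le> 1" using v i by (auto simp: prop_dom_def PiE_iff)
      ultimately show ?thesis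
        using assms i bounds[OF shift[OF v], of "i - 1"] by (cases i) (simp_all add: max_def)
    qed
    then show "F c = c"
      unfolding F_def
      by (subst (2) c_def, intro arg_cong[of _ _ FunV] arg_cong[of _ _ PropV] restrict_ext) blast
  next
    fix w assume w: "w \<in> val_dom {..K} (Arr Prop Prop)" "F w = w"
    have dom: "fun_of w v \<in> val_dom {..K} Prop" if "v \<in> prop_dom {..K}" for v
      using w(1) that by (auto dest: PiE_mem)
    have eq: "prop_of (fun_of w v) i = max (min (if i \<in> L q then 1 else 0) (v i))
      (min (if i \<in> L p then 1 else 0) (prop_of (fun_of w (shift v)) (i - 1)))"
      if "v \<in> prop_dom {..K}" "i \<le> K" for v i
      by (subst w(2)[symmetric]) (use that in \<open>simp add: F_def\<close>)
    have "v \<in> prop_dom {..K} \<Longrightarrow> i \<le> K \<Longrightarrow> compare_val (L p) v i \<le> prop_of (fun_of w v) i" for v i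
    proof (induction i arbitrary: v)
      case 0
      then show ?case using val_dom_PropD[OF dom[of v], of 0] by simp
    next
      case (Suc i)
      have "compare_val (L p) (shift v) i = compare_val (L p) (\<lambda>j. v (j - 1)) i"
        using Suc.prems by (intro compare_val_cong) (simp add: shift_def)
      moreover have "0 \<le> v (Suc i)" "v (Suc i) \<le> 1"
        using Suc.prems by (auto simp: prop_dom_def PiE_iff)
      ultimately show ?case
        using Suc.IH[OF shift[OF Suc.prems(1)]] eq[OF Suc.prems] Suc.prems assms(1)
          val_dom_PropD[OF dom[OF shift[OF Suc.prems(1)]], of i]
        by (auto simp: max_def min_def)
    qed
    then show "val_le {..K} (Arr Prop Prop) c w" by (simp add: c_def)
  qed
  then show ?thesis
    unfolding compare_fun_def sem.simps(9) F line_chain_simps c_def .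
qed

text \<open>The argument \<open>p\<close> is read at state \<open>m - n\<close>, which is at most
  \<open>m\<close> and hence labeled \<open>p\<close> only if it is 0.\<close>

lemma models_compare_formula:
  assumes "L q = - L p" "L p = insert 0 {m<..}" "m > 0"
  shows "models (line_chain L (m + n)) (compare_formula p q) \<longleftrightarrow> m \<le> n"
proof -
  define v :: "nat \<Rightarrow> real" where "v = (\<lambda>i\<in>{..m + n}. if i \<in> L p then 1 else 0)"
  have v: "v \<in> prop_dom {..m + n}" by (auto simp: v_def prop_dom_def)
  have atom: "sem (line_chain L (m + n)) (Atom p) Prop \<rho> = PropV v" for \<rho>
    by (auto simp: v_def intro!: restrict_ext)
  have "compare_val (L p) v (m + n) = v (m - n)"
    using assms by (intro compare_val_prefix) auto
  then show ?thesis
    unfolding models_def compare_formula_def sem.simps(12) atom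
    using sem_compare_fun[of L q p] assms v
    by (auto simp: v_def)
qed

section \<open>Separation from every order-zero formula\<close>

theorem theorem2p9:
  fixes neg :: "'p \<Rightarrow> 'p"
  assumes "\<exists>M :: (nat, 'p) mchain. markov_chain neg M"
  shows "\<exists>\<phi> :: 'p phfl. closed_prop 1 \<phi> \<and>
           (\<forall>\<phi>' :: 'p phfl. closed_prop 0 \<phi>' \<longrightarrow>
              (\<exists>M :: (nat, 'p) mchain. markov_chain neg M \<and>
                 ((models M \<phi> \<and> \<not> models M \<phi>') \<or> (\<not> models M \<phi> \<and> models M \<phi>'))))"
proof -
  from assms obtain M0 :: "(nat, 'p) mchain" where M0: "markov_chain neg M0" by blast
  \<comment> \<open>One state of any chain gives a truth assignment compatible with
    \<open>neg\<close>; this is where the existence hypothesis enters.\<close>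
  define pos where "pos p \<longleftrightarrow> init M0 \<in> label M0 p" for p
  have pos_neg: "pos (neg p) \<longleftrightarrow> \<not> pos p" for p
    using M0 by (auto simp: pos_def markov_chain_def)
  then obtain p where p: "pos p" by blast
  \<comment> \<open>Every proposition behaves like \<open>p\<close> or like its complement, so the
    chain is a two-letter word respecting \<open>neg\<close>.\<close>
  define L where "L m r = (if pos r then insert 0 {m<..} else - insert 0 {m<..})" for m :: nat and r
  have neg: "L m (neg r) = - L m r" for m r
    by (simp add: L_def pos_neg)
  have Lp: "L m p = insert 0 {m<..}" for m by (simp add: L_def p)
  show ?thesis
  proof (intro exI[of _ "compare_formula p (neg p)"] conjI allI impI)
    fix \<phi> :: "'p phfl" assume \<phi>: "closed_prop 0 \<phi>"
    define \<beta> :: "nat \<Rightarrow> nat \<Rightarrow> bool" where "\<beta> = (\<lambda>_ _. False)"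
    \<comment> \<open>The successor keeps the \<open>q\<close>-block nonempty, as
      \<open>models_compare_formula\<close> requires.\<close>
    define c where "c m = profile (L (Suc m)) \<phi> \<beta> (Suc m)" for m
    have "range c \<subseteq> {xs. set xs \<subseteq> UNIV \<and> length xs = length (c 0)}"
      by (auto simp: c_def intro: length_profile)
    then have "finite (range c)"
      using finite_lists_length_eq[of "UNIV :: bool set"] by (auto intro: finite_subset)
    then have "\<not> inj c" using finite_imageD infinite_UNIV_nat by blast
    then obtain m k where mk: "0 < m" "m < k" "profile (L m) \<phi> \<beta> m = profile (L k) \<phi> \<beta> k"
      unfolding inj_def c_def by (metis linorder_neqE_nat Suc_less_eq zero_less_Suc)
    have label: "Suc (m + n) \<in> L m r \<longleftrightarrow> Suc (k + n) \<in> L k r" for n r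
      by (auto simp: L_def)
    have profile: "profile (L m) \<phi> \<beta> (m + n) = profile (L k) \<phi> \<beta> (k + n)" for n
      by (induction n) (use mk(3) profile_step[of _ "L m" _ "L k", OF label] in \<open>auto simp: \<beta>_def\<close>)
    have "bsem (L m) \<phi> \<beta> (Suc (m + n)) = bsem (L k) \<phi> \<beta> (Suc (k + n))" for n
      using profile_step[of _ "L m" _ "L k", OF label profile] by (simp add: \<beta>_def)
    \<comment> \<open>The prefix has length \<open>m\<close> in both words, so the order-one formula
      compares \<open>m \<le> m\<close> with \<open>k \<le> m\<close>. The index is
      \<open>m - 1\<close> because the last step of the prefix yields the truth value of the whole
      formula.\<close>
    from this[of "m - 1"] have
      "models (line_chain (L m) (m + m)) \<phi> \<longleftrightarrow> models (line_chain (L k) (k + m)) \<phi>"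
      using mk(1) by (simp add: models_line_chain_iff[OF \<phi>, of _ _ \<beta>])
    moreover have "models (line_chain (L m) (m + m)) (compare_formula p (neg p))"
      "\<not> models (line_chain (L k) (k + m)) (compare_formula p (neg p))"
      using models_compare_formula[of "L j" "neg p" p j m for j, OF neg Lp] mk(1,2) by auto
    moreover have "markov_chain neg (line_chain (L j) i)" for j i
      using neg by (rule markov_chain_line_chain)
    ultimately show "\<exists>M :: (nat, 'p) mchain. markov_chain neg M \<and>
       ((models M (compare_formula p (neg p)) \<and> \<not> models M \<phi>) \<or>
        (\<not> models M (compare_formula p (neg p)) \<and> models M \<phi>))"
      by blast
  qed (rule closed_compare_formula)
qed

end
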